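(* For every $n\ge1$ there exists a bijection between the set of $2\times n$ Nurikabe grids and the set of strings appearing in the list $\mathbb{S}(n)$ (defined in the context).
   Context: A $2\times n$ Nurikabe grid is a black/white coloring of the cells of a $2\times n$ grid such that the black cells are edge-connected (possibly empty) and no $2\times 2$ subgrid is entirely black. The list $\mathbb{S}(n)$ of strings over $\{0,1,2,3\}$ of length $n$ is defined as follows. Set $\mathbb{S}(1)=\mathrm{core}(1)=0,1,2,3$. For $n\ge2$, set $\mathbb{S}(n)=0\cdot\mathbb{S}(n-1),\ \mathrm{core}(n)[1:]$, where $$\mathrm{core}(n)=03^{n-1},\ 1\cdot\overleftarrow{\mathrm{core}(n-1)},\ 2\cdot\mathrm{core}(n-1),\ 3^n.$$ Here $d\cdot L$ prefixes digit $d$ to every string of list $L$, $\overleftarrow{L}$ is the reversed list, commas denote concatenation, exponents denote repetition, and $L[1:]$ is $L$ with its first element removed. The strings of $\mathbb{S}(n)$ are exactly the states on the shortest solution of a Ziggu puzzle with $n$ digits. *)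

theory Defs
  imports Main "HOL-Library.FuncSet"
begin

type_synonym cell = "nat \<times> nat"

datatype colour = Black | White

text \<open>A cell is a pair (row, column), both counted from 0.\<close>

definition grid_cells :: "nat \<Rightarrow> cell set" where
  "grid_cells n = {..<2} \<times> {..<n}"

definition edge_adjacent :: "cell \<Rightarrow> cell \<Rightarrow> bool" where
  "edge_adjacent p q \<longleftrightarrow>
     (fst p = fst q \<and> (snd q = Suc (snd p) \<or> snd p = Suc (snd q))) \<or>
     (snd p = snd q \<and> (fst q = Suc (fst p) \<or> fst p = Suc (fst q)))"

definition edge_connected :: "cell set \<Rightarrow> bool" where
  "edge_connected B \<longleftrightarrow>
     (\<forall>p\<in>B. \<forall>q\<in>B. (p, q) \<in> {(a, b). a \<in> B \<and> b \<in> B \<and> edge_adjacent a b}\<^sup>*)"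

definition black_cells :: "nat \<Rightarrow> (cell \<Rightarrow> colour) \<Rightarrow> cell set" where
  "black_cells n f = {p \<in> grid_cells n. f p = Black}"

text \<open>The extensional function space gives exactly one function for each colouring of the
  \<open>2 \<times> n\<close> cells. A \<open>2 \<times> 2\<close> block of black cells automatically lies inside the grid.\<close>

definition nurikabe_grids :: "nat \<Rightarrow> (cell \<Rightarrow> colour) set" where
  "nurikabe_grids n =
     {f \<in> grid_cells n \<rightarrow>\<^sub>E UNIV.
        edge_connected (black_cells n f) \<and>
        \<not> (\<exists>i j. {i, Suc i} \<times> {j, Suc j} \<subseteq> black_cells n f)}"

text \<open>Strings are lists of digits. The values at length 0 are not part of the mathematical
  definition; they only make the functions total.\<close>

fun ziggu_core :: "nat \<Rightarrow> nat list list" where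
  "ziggu_core 0 = []"
| "ziggu_core (Suc 0) = [[0], [1], [2], [3]]"
| "ziggu_core (Suc (Suc m)) =
     [0 # replicate (Suc m) 3]
     @ map ((#) 1) (rev (ziggu_core (Suc m)))
     @ map ((#) 2) (ziggu_core (Suc m))
     @ [replicate (Suc (Suc m)) 3]"

fun ziggu_strings :: "nat \<Rightarrow> nat list list" where
  "ziggu_strings 0 = []"
| "ziggu_strings (Suc 0) = ziggu_core 1"
| "ziggu_strings (Suc (Suc m)) =
     map ((#) 0) (ziggu_strings (Suc m)) @ tl (ziggu_core (Suc (Suc m)))"

end

theory Submission
  imports Defs
begin

text \<open>Both sets are finite, so it suffices to see that they have the same cardinality
  \<open>6 \<cdot> 2\<^sup>n - 3n - 5\<close>. A colouring is Nurikabe iff, whenever there are black cells in columns \<open>\<le> j\<close>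
  and in columns \<open>> j\<close>, the columns \<open>j\<close> and \<open>j + 1\<close> have exactly one row in which both are black:
  at least one for connectedness, at most one to avoid a black block. Every column with a black
  cell has exactly two possible black successors of this kind, so there are \<open>2\<^sup>m\<^sup>+\<^sup>1 - 1\<close> ways to
  continue it by \<open>m\<close> columns, and \<open>3(2\<^sup>n - 1)\<close> grids with a black cell in the first column.
  This is also the number of strings in \<open>core(n)[1:]\<close>.\<close>

subsection \<open>Connected sets in two rows\<close>

text \<open>A path of black cells from \<open>p\<close> to \<open>q\<close> must cross from column
  \<open>j\<close> to \<open>Suc j\<close>, and the crossing step is horizontal, so it supplies the
  common row \<open>r\<close>. Without such a row, \<open>snd \<le> j\<close> would be invariant
  along the path.\<close>

lemma edge_connected_imp_linked:
  assumes conn: "edge_connected B" and p: "p \<in> B" and q: "q \<in> B"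
    and j: "snd p \<le> j" "j < snd q"
  shows "\<exists>r. (r, j) \<in> B \<and> (r, Suc j) \<in> B"
proof (rule ccontr)
  assume unlinked: "\<not> ?thesis"
  let ?R = "{(a, b). a \<in> B \<and> b \<in> B \<and> edge_adjacent a b}"
  have "(p, q) \<in> ?R\<^sup>*"
    using conn p q by (auto simp: edge_connected_def)
  then have "snd q \<le> j"
  proof (induction rule: rtrancl_induct)
    case base
    show ?case using j by simp
  next
    case (step y z)
    show ?case
    proof (rule ccontr)
      assume "\<not> snd z \<le> j"
      then have "y = (fst y, j)" "z = (fst y, Suc j)"
        using step by (auto simp: edge_adjacent_def prod_eq_iff)
      then show False
        using step.hyps unlinked by (metis (no_types, lifting) case_prodD mem_Collect_eq)
    qed
  qed
  with j show False by simp
qed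

text \<open>With only two rows, black cells of one column are equal or adjacent. Hence one can walk
  from column to column along the linking rows, changing rows inside a column where
  necessary.\<close>

lemma linked_imp_edge_connected:
  assumes rows: "B \<subseteq> {..<2} \<times> UNIV"
    and linked: "\<And>p q j. \<lbrakk>p \<in> B; q \<in> B; snd p \<le> j; j < snd q\<rbrakk>
      \<Longrightarrow> \<exists>r. (r, j) \<in> B \<and> (r, Suc j) \<in> B"
  shows "edge_connected B"
proof -
  let ?R = "{(a, b). a \<in> B \<and> b \<in> B \<and> edge_adjacent a b}"
  have sym: "sym (?R\<^sup>*)"
    by (rule sym_rtrancl) (auto simp: sym_def edge_adjacent_def)
  have same_col: "(p, q) \<in> ?R\<^sup>*" if "p \<in> B" "q \<in> B" "snd p = snd q" for p q
  proof (cases "p = q")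
    case False
    obtain a b c where pq: "p = (a, b)" "q = (c, b)"
      using \<open>snd p = snd q\<close> by (metis prod.collapse)
    have "a < 2" "c < 2" using rows that pq by auto
    with False pq have "edge_adjacent p q"
      by (auto simp: edge_adjacent_def less_2_cases_iff)
    with that show ?thesis by blast
  qed simp
  have forward: "(p, q) \<in> ?R\<^sup>*" if "p \<in> B" "q \<in> B" "snd q = snd p + k" for p q k
    using that
  proof (induction k arbitrary: p)
    case 0
    then show ?case by (intro same_col) auto
  next
    case (Suc k)
    obtain r where r: "(r, snd p) \<in> B" "(r, Suc (snd p)) \<in> B"
      using linked[of p q "snd p"] Suc.prems by auto
    have "(p, (r, snd p)) \<in> ?R\<^sup>*"
      using Suc.prems r by (intro same_col) auto
    moreover have "((r, snd p), (r, Suc (snd p))) \<in> ?R"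
      using r by (auto simp: edge_adjacent_def)
    moreover have "((r, Suc (snd p)), q) \<in> ?R\<^sup>*"
      using Suc.prems r by (intro Suc.IH) auto
    ultimately show ?case
      by (meson rtrancl.rtrancl_into_rtrancl rtrancl_trans)
  qed
  have "(p, q) \<in> ?R\<^sup>*" if "p \<in> B" "q \<in> B" for p q
  proof (cases "snd p \<le> snd q")
    case True
    with forward[OF that, of "snd q - snd p"] show ?thesis by simp
  next
    case False
    with forward[of q p "snd p - snd q"] that have "(q, p) \<in> ?R\<^sup>*" by simp
    \<comment> \<open>\<open>forward\<close> only walks to the right; symmetry of adjacency gives
      the other direction.\<close>
    with sym show ?thesis by (rule symD)
  qed
  then show ?thesis by (auto simp: edge_connected_def)
qed

lemma edge_connected_no_block_iff:
  assumes rows: "B \<subseteq> {..<2} \<times> UNIV"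
  shows "edge_connected B \<and> \<not> (\<exists>i j. {i, Suc i} \<times> {j, Suc j} \<subseteq> B) \<longleftrightarrow>
    (\<forall>p\<in>B. \<forall>q\<in>B. \<forall>j. snd p \<le> j \<longrightarrow> j < snd q \<longrightarrow>
      ((0, j) \<in> B \<and> (0, Suc j) \<in> B) \<noteq> ((1, j) \<in> B \<and> (1, Suc j) \<in> B))"
    (is "?L \<longleftrightarrow> ?R")
proof
  assume L: ?L
  show ?R
  proof (intro ballI allI impI)
    fix p q j assume pq: "p \<in> B" "q \<in> B" "snd p \<le> j" "j < snd q"
    obtain r where r: "(r, j) \<in> B" "(r, Suc j) \<in> B"
      using edge_connected_imp_linked pq L by blast
    then have "r < 2" using rows by auto
    moreover have "\<not> {0, Suc 0} \<times> {j, Suc j} \<subseteq> B" using L by blast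
    ultimately show "((0, j) \<in> B \<and> (0, Suc j) \<in> B) \<noteq> ((1, j) \<in> B \<and> (1, Suc j) \<in> B)"
      using r by (auto simp: less_2_cases_iff)
  qed
next
  assume R: ?R
  have "edge_connected B"
    using rows by (rule linked_imp_edge_connected) (use R in blast)
  moreover have False if block: "{i, Suc i} \<times> {j, Suc j} \<subseteq> B" for i j
  proof -
    have "i = 0" using block rows by auto
    with block have "(0, j) \<in> B" "(0, Suc j) \<in> B" "(1, j) \<in> B" "(1, Suc j) \<in> B" by auto
    \<comment> \<open>The block itself supplies black cells on both sides of the boundary, where
      both rows would then be linked.\<close>
    with R[rule_format, of "(0, j)" "(0, Suc j)" j] show False by auto
  qed
  ultimately show ?L by blast
qed

subsection \<open>Grids as words of columns\<close>

text \<open>A column is the pair of truth values telling whether its top and bottom cell are black.\<close>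

type_synonym column = "bool \<times> bool"

abbreviation white_column :: column where
  "white_column \<equiv> (False, False)"

definition one_common_row :: "column \<Rightarrow> column \<Rightarrow> bool" where
  "one_common_row c d \<longleftrightarrow> (fst c \<and> fst d) \<noteq> (snd c \<and> snd d)"

definition nurikabe_word :: "column list \<Rightarrow> bool" where
  "nurikabe_word w \<longleftrightarrow>
     (\<forall>i j k. i \<le> j \<longrightarrow> j < k \<longrightarrow> k < length w \<longrightarrow> w ! i \<noteq> white_column \<longrightarrow> w ! k \<noteq> white_column
        \<longrightarrow> one_common_row (w ! j) (w ! Suc j))"

definition columns :: "nat \<Rightarrow> (cell \<Rightarrow> colour) \<Rightarrow> column list" where
  "columns n f = map (\<lambda>j. (f (0, j) = Black, f (1, j) = Black)) [0..<n]"

text \<open>Inverse of \<open>columns n\<close> on words of length \<open>n\<close>;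
  \<open>restrict\<close> puts the result into the extensional function space.\<close>

definition colouring :: "nat \<Rightarrow> column list \<Rightarrow> cell \<Rightarrow> colour" where
  "colouring n w = restrict (\<lambda>(r, j).
     if (if r = 0 then fst (w ! j) else snd (w ! j)) then Black else White) (grid_cells n)"

lemma colouring_columns:
  assumes "f \<in> grid_cells n \<rightarrow>\<^sub>E UNIV"
  shows "colouring n (columns n f) = f"
proof (rule extensionalityI[of _ "grid_cells n"])
  fix p assume p: "p \<in> grid_cells n"
  obtain r j where [simp]: "p = (r, j)" by (cases p)
  have White: "f q = White" if "f q \<noteq> Black" for q
    using that by (cases "f q") auto
  from p have "r < 2" "j < n" by (auto simp: grid_cells_def)
  then show "colouring n (columns n f) p = f p"
    using p by (auto simp: colouring_def columns_def less_2_cases_iff White)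
qed (use assms in \<open>auto simp: colouring_def PiE_def\<close>)

lemma columns_colouring:
  assumes "length w = n"
  shows "columns n (colouring n w) = w"
  using assms
  by (intro nth_equalityI) (auto simp: columns_def colouring_def grid_cells_def prod_eq_iff)

lemma length_columns [simp]: "length (columns n f) = n"
  by (simp add: columns_def)

lemma nurikabe_word_columns_iff:
  "nurikabe_word (columns n f) \<longleftrightarrow>
     edge_connected (black_cells n f) \<and> \<not> (\<exists>i j. {i, Suc i} \<times> {j, Suc j} \<subseteq> black_cells n f)"
proof -
  let ?B = "black_cells n f"
  have rows: "?B \<subseteq> {..<2} \<times> UNIV"
    by (auto simp: black_cells_def grid_cells_def)
  \<comment> \<open>The bound \<open>j < n\<close> has to be explicit, as \<open>!\<close> is
    unspecified past the end of the list.\<close>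
  have occupied: "(\<exists>r. (r, j) \<in> ?B) \<longleftrightarrow> j < n \<and> columns n f ! j \<noteq> white_column" for j
    by (auto simp: black_cells_def grid_cells_def columns_def less_2_cases_iff)
  have common: "one_common_row (columns n f ! j) (columns n f ! Suc j) \<longleftrightarrow>
      ((0, j) \<in> ?B \<and> (0, Suc j) \<in> ?B) \<noteq> ((1, j) \<in> ?B \<and> (1, Suc j) \<in> ?B)" if "Suc j < n" for j
    using that by (auto simp: black_cells_def grid_cells_def columns_def one_common_row_def)
  have by_columns: "(\<forall>p\<in>?B. \<forall>q\<in>?B. \<forall>j. snd p \<le> j \<longrightarrow> j < snd q \<longrightarrow> P j) \<longleftrightarrow>
      (\<forall>i j k. i \<le> j \<longrightarrow> j < k \<longrightarrow> (\<exists>r. (r, i) \<in> ?B) \<longrightarrow> (\<exists>r. (r, k) \<in> ?B) \<longrightarrow> P j)" for P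
    by (simp add: Ball_def) blast
  let ?P = "\<lambda>j. ((0, j) \<in> ?B \<and> (0, Suc j) \<in> ?B) \<noteq> ((1, j) \<in> ?B \<and> (1, Suc j) \<in> ?B)"
  have "nurikabe_word (columns n f) \<longleftrightarrow> (\<forall>i j k. i \<le> j \<longrightarrow> j < k \<longrightarrow>
      (\<exists>r. (r, i) \<in> ?B) \<longrightarrow> (\<exists>r. (r, k) \<in> ?B) \<longrightarrow> ?P j)"
    unfolding nurikabe_word_def occupied length_columns
  proof (intro iff_allI)
    fix i j k
    show "(i \<le> j \<longrightarrow> j < k \<longrightarrow> k < n \<longrightarrow> columns n f ! i \<noteq> white_column \<longrightarrow>
        columns n f ! k \<noteq> white_column \<longrightarrow> one_common_row (columns n f ! j) (columns n f ! Suc j)) \<longleftrightarrow>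
      (i \<le> j \<longrightarrow> j < k \<longrightarrow> i < n \<and> columns n f ! i \<noteq> white_column \<longrightarrow>
        k < n \<and> columns n f ! k \<noteq> white_column \<longrightarrow> ?P j)"
    proof (cases "i \<le> j \<and> j < k \<and> k < n")
      case True
      then have "i < n" "Suc j < n" by auto
      with True common show ?thesis by metis
    qed blast
  qed
  then show ?thesis
    unfolding edge_connected_no_block_iff[OF rows] by_columns .
qed

lemma bij_betw_columns:
  "bij_betw (columns n) (nurikabe_grids n) {w. length w = n \<and> nurikabe_word w}"
proof (rule bij_betw_byWitness[where f' = "colouring n"])
  show "\<forall>f\<in>nurikabe_grids n. colouring n (columns n f) = f"
    by (auto simp: nurikabe_grids_def colouring_columns)
  show "\<forall>w\<in>{w. length w = n \<and> nurikabe_word w}. columns n (colouring n w) = w"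
    by (auto simp: columns_colouring)
  show "columns n ` nurikabe_grids n \<subseteq> {w. length w = n \<and> nurikabe_word w}"
    by (auto simp: nurikabe_grids_def nurikabe_word_columns_iff)
  show "colouring n ` {w. length w = n \<and> nurikabe_word w} \<subseteq> nurikabe_grids n"
  proof clarify
    fix w assume w: "nurikabe_word w" "n = length w"
    then have "nurikabe_word (columns n (colouring n w))"
      by (simp add: columns_colouring)
    moreover have "colouring n w \<in> grid_cells n \<rightarrow>\<^sub>E UNIV"
      by (simp add: colouring_def)
    ultimately show "colouring (length w) w \<in> nurikabe_grids (length w)"
      using w by (simp add: nurikabe_grids_def nurikabe_word_columns_iff)
  qed
qed

subsection \<open>Counting words\<close>

lemma nurikabe_word_Nil [simp]: "nurikabe_word []"
  by (simp add: nurikabe_word_def)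

text \<open>A leading white column cannot serve as the left witness \<open>i\<close>, so all
  relevant indices are positive and shift down by one.\<close>

lemma nurikabe_word_white_Cons: "nurikabe_word (white_column # w) \<longleftrightarrow> nurikabe_word w"
proof
  assume w: "nurikabe_word (white_column # w)"
  show "nurikabe_word w"
    unfolding nurikabe_word_def
  proof (intro allI impI)
    fix i j k
    assume "i \<le> j" "j < k" "k < length w" "w ! i \<noteq> white_column" "w ! k \<noteq> white_column"
    with w[unfolded nurikabe_word_def, rule_format, of "Suc i" "Suc j" "Suc k"]
    show "one_common_row (w ! j) (w ! Suc j)" by simp
  qed
next
  assume w: "nurikabe_word w"
  show "nurikabe_word (white_column # w)"
    unfolding nurikabe_word_def
  proof (intro allI impI)
    fix i j k
    let ?v = "white_column # w"
    assume *: "i \<le> j" "j < k" "k < length ?v" "?v ! i \<noteq> white_column" "?v ! k \<noteq> white_column"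
    obtain i' where "i = Suc i'" using * by (cases i) auto
    moreover obtain j' where "j = Suc j'" using * calculation by (cases j) auto
    moreover obtain k' where "k = Suc k'" using * by (cases k) auto
    ultimately show "one_common_row (?v ! j) (?v ! Suc j)"
      using * w[unfolded nurikabe_word_def, rule_format, of i' j' k'] by simp
  qed
qed

text \<open>A leading black column is a left witness for every boundary, so any later black column
  forces a link between \<open>c\<close> and \<open>d\<close>.\<close>

lemma nurikabe_word_black_Cons:
  assumes c: "c \<noteq> white_column"
  shows "nurikabe_word (c # d # w) \<longleftrightarrow>
    (\<forall>x\<in>set (d # w). x = white_column) \<or> one_common_row c d \<and> nurikabe_word (d # w)"
    (is "?L \<longleftrightarrow> ?W \<or> ?C")
proof
  assume L: ?L
  show "?W \<or> ?C"
  proof (rule disjCI)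
    assume "\<not> ?C"
    have tail: "nurikabe_word (d # w)"
      unfolding nurikabe_word_def
    proof (intro allI impI)
      fix i j k
      assume "i \<le> j" "j < k" "k < length (d # w)"
        "(d # w) ! i \<noteq> white_column" "(d # w) ! k \<noteq> white_column"
      with L[unfolded nurikabe_word_def, rule_format, of "Suc i" "Suc j" "Suc k"]
      show "one_common_row ((d # w) ! j) ((d # w) ! Suc j)" by simp
    qed
    show ?W
    proof (rule ccontr)
      assume "\<not> ?W"
      then obtain k where "k < length (d # w)" "(d # w) ! k \<noteq> white_column"
        by (metis in_set_conv_nth)
      with L[unfolded nurikabe_word_def, rule_format, of 0 0 "Suc k"] c
      have "one_common_row c d" by simp
      with tail \<open>\<not> ?C\<close> show False by blast
    qed
  qed
next
  assume R: "?W \<or> ?C"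
  show ?L
    unfolding nurikabe_word_def
  proof (intro allI impI)
    fix i j k
    let ?v = "c # d # w"
    assume *: "i \<le> j" "j < k" "k < length ?v" "?v ! i \<noteq> white_column" "?v ! k \<noteq> white_column"
    obtain k' where k: "k = Suc k'" using * by (cases k) auto
    then have "(d # w) ! k' \<in> set (d # w)" "(d # w) ! k' \<noteq> white_column"
      using * by (auto intro!: nth_mem simp del: set_simps)
    with R have C: ?C by blast
    then have "d \<noteq> white_column" by (auto simp: one_common_row_def)
    show "one_common_row (?v ! j) (?v ! Suc j)"
    proof (cases j)
      case 0
      with C show ?thesis by simp
    next
      case (Suc j')
      \<comment> \<open>For \<open>i = 0\<close> the witness \<open>c\<close> is missing from the
        tail; there \<open>i - 1 = 0\<close>, and \<open>d\<close> takes its place.\<close>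
      have "(d # w) ! (i - 1) \<noteq> white_column"
        using * \<open>d \<noteq> white_column\<close> by (cases i) auto
      with Suc k * C[THEN conjunct2, unfolded nurikabe_word_def, rule_format, of "i - 1" j' k']
      show ?thesis by simp
    qed
  qed
qed

lemma finite_words: "finite {w :: column list. length w = m \<and> P w}"
  by (rule finite_subset[OF _ finite_lists_length_eq[of UNIV m]]) auto

lemma nurikabe_word_black_replicate:
  assumes "c \<noteq> white_column"
  shows "nurikabe_word (c # replicate m white_column)"
  using assms
  by (cases m) (auto simp: nurikabe_word_black_Cons, simp add: nurikabe_word_def)

lemma card_one_common_row:
  assumes "c \<noteq> white_column"
  shows "card {d. one_common_row c d} = 2"
proof -
  \<comment> \<open>A full column is followed by one of the two single-cell columns, a single-cell
    column by itself or the full one.\<close>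
  have "{d. one_common_row c d} =
      (if c = (True, True) then {(False, True), (True, False)} else {c, (True, True)})"
    using assms by (cases c) (auto simp: one_common_row_def)
  with assms show ?thesis by auto
qed

text \<open>The number a(m) of continuations satisfies a(0) = 1 and a(m + 1) = 1 + 2 a(m): either
  all remaining columns are white, or one of two linked columns comes next.\<close>

lemma card_nurikabe_word_black:
  assumes "c \<noteq> white_column"
  shows "card {w. length w = m \<and> nurikabe_word (c # w)} + 1 = 2 ^ Suc m"
  using assms
proof (induction m arbitrary: c)
  case 0
  have "{w. length w = 0 \<and> nurikabe_word (c # w)} = {[]}"
    using nurikabe_word_black_replicate[OF 0, of 0] by auto
  then show ?case by simp
next
  case (Suc m)
  let ?W = "\<lambda>d. {w. length w = m \<and> nurikabe_word (d # w)}"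
  let ?D = "{d. one_common_row c d}"
  let ?U = "\<Union>d\<in>?D. (#) d ` ?W d"
  \<comment> \<open>This makes the induction hypothesis applicable to \<open>d\<close> and keeps the
    all-white continuation out of \<open>?U\<close>.\<close>
  have black: "d \<noteq> white_column" if "d \<in> ?D" for d
    using that by (auto simp: one_common_row_def)
  have "{w. length w = Suc m \<and> nurikabe_word (c # w)} = insert (replicate (Suc m) white_column) ?U"
    (is "?A = ?R")
  proof (rule set_eqI)
    fix w
    show "w \<in> ?A \<longleftrightarrow> w \<in> ?R"
    proof (cases w)
      case (Cons d v)
      have "w = replicate (Suc m) white_column \<longleftrightarrow>
          length w = Suc m \<and> (\<forall>x\<in>set w. x = white_column)"
        by (metis in_set_replicate length_replicate replicate_eqI)
      then have white: "w = replicate (Suc m) white_column \<longleftrightarrow>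
          length v = m \<and> (\<forall>x\<in>set (d # v). x = white_column)"
        unfolding Cons by (simp only: length_Cons nat.inject)
      have black_tail: "w \<in> ?U \<longleftrightarrow> one_common_row c d \<and> length v = m \<and> nurikabe_word (d # v)"
        unfolding Cons by blast
      have "w \<in> ?A \<longleftrightarrow> length v = m \<and> nurikabe_word (c # d # v)"
        by (simp add: Cons)
      also have "\<dots> \<longleftrightarrow> w \<in> ?R"
        unfolding nurikabe_word_black_Cons[OF Suc.prems] insert_iff white black_tail by blast
      finally show ?thesis .
    qed auto
  qed
  moreover have "replicate (Suc m) white_column \<notin> ?U"
    using black by auto
  moreover have "finite ?U"
    by (intro finite_UN_I finite_imageI finite_words) simp
  moreover have "card ?U = (\<Sum>d\<in>?D. card ((#) d ` ?W d))"
    by (rule card_UN_disjoint) (auto intro: finite_words)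
  moreover have "\<dots> = (\<Sum>d\<in>?D. 2 ^ Suc m - 1)"
  proof (rule sum.cong)
    fix d assume "d \<in> ?D"
    from Suc.IH[OF black[OF this]] show "card ((#) d ` ?W d) = 2 ^ Suc m - 1"
      by (simp add: card_image)
  qed simp
  moreover have "\<dots> = 2 * (2 ^ Suc m - 1)"
    using card_one_common_row[OF Suc.prems] by simp
  ultimately have "card {w. length w = Suc m \<and> nurikabe_word (c # w)} = Suc (2 * (2 ^ Suc m - 1))"
    by simp
  moreover have "(1::nat) \<le> 2 ^ Suc m" by simp
  ultimately show ?case
    unfolding power_Suc[of 2 "Suc m"] by linarith
qed

text \<open>Splitting by the first column: a white one leaves any shorter word, and each of the
  three black ones has \<open>2 ^ Suc m - 1\<close> continuations.\<close>

lemma card_nurikabe_words: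
  "card {w. length w = m \<and> nurikabe_word w} + 3 * m + 5 = 6 * 2 ^ m"
proof (induction m)
  case 0
  have "{w. length w = 0 \<and> nurikabe_word w} = {[]}" by auto
  then show ?case by simp
next
  case (Suc m)
  let ?W = "\<lambda>d. (#) d ` {w. length w = m \<and> nurikabe_word (d # w)}"
  let ?D = "{(False, True), (True, False), (True, True)}"
  have UNIV_column: "(UNIV :: column set) = insert white_column ?D" by auto
  have white: "card (?W white_column) = card {w. length w = m \<and> nurikabe_word w}"
    by (simp add: card_image nurikabe_word_white_Cons)
  have black: "card (?W d) = 2 ^ Suc m - 1" if "d \<in> ?D" for d
  proof -
    have "d \<noteq> white_column" using that by auto
    from card_nurikabe_word_black[OF this, of m] show ?thesis
      by (simp add: card_image)
  qed
  have "{w. length w = Suc m \<and> nurikabe_word w} = (\<Union>d\<in>UNIV. ?W d)"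
    by (auto simp: length_Suc_conv)
  also have "card \<dots> = (\<Sum>d\<in>UNIV. card (?W d))"
    by (rule card_UN_disjoint) (auto intro: finite_words)
  also have "\<dots> = card (?W white_column) + (\<Sum>d\<in>?D. card (?W d))"
    unfolding UNIV_column by (rule sum.insert) auto
  also have "(\<Sum>d\<in>?D. card (?W d)) = (\<Sum>d\<in>?D. 2 ^ Suc m - 1)"
    using black by (rule sum.cong[OF refl])
  also have "\<dots> = 3 * (2 ^ Suc m - 1)"
    by simp
  finally have "card {w. length w = Suc m \<and> nurikabe_word w} =
      card {w. length w = m \<and> nurikabe_word w} + 3 * (2 ^ Suc m - 1)"
    unfolding white .
  \<comment> \<open>Writing the power as a successor eliminates the truncated subtraction.\<close>
  moreover obtain k :: nat where "2 ^ m = Suc k"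
    using not0_implies_Suc[of "2 ^ m"] by auto
  ultimately show ?case
    using Suc.IH by simp
qed

section \<open>Counting Ziggu strings\<close>

lemma distinct_ziggu_core: "distinct (ziggu_core n)"
  by (induction n rule: ziggu_core.induct) (auto simp: distinct_map)

text \<open>Each level has two copies of the previous one and two more strings, so the length plus 2
  doubles, starting from 6.\<close>

lemma length_ziggu_core: "length (ziggu_core (Suc m)) + 2 = 6 * 2 ^ m"
  by (induction m) auto

text \<open>\<open>tl\<close> removes the only string of the core that starts with 0, so the core
  part cannot meet the part prefixed by 0.\<close>

lemma distinct_ziggu_strings: "distinct (ziggu_strings n)"
proof (induction n rule: ziggu_strings.induct)
  case (3 m)
  then show ?case
    by (auto simp: distinct_map distinct_ziggu_core)
qed auto

text \<open>The shortened core adds \<open>3 * (2 ^ Suc (Suc m) - 1)\<close> strings, the same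
  increment as for words. The formula fails for the default value at 0, hence
  \<open>Suc m\<close>.\<close>

lemma length_ziggu_strings: "length (ziggu_strings (Suc m)) + 3 * Suc m + 5 = 6 * 2 ^ Suc m"
proof (induction m)
  case (Suc m)
  then show ?case using length_ziggu_core[of "Suc m"] by simp
qed simp

theorem theorem11p3:
  fixes n :: nat
  assumes "n \<ge> 1"
  shows "\<exists>\<phi>. bij_betw \<phi> (nurikabe_grids n) (set (ziggu_strings n))"
proof -
  have "card (set (ziggu_strings n)) + 3 * n + 5 = 6 * 2 ^ n"
    using assms length_ziggu_strings[of "n - 1"]
    by (simp add: distinct_card[OF distinct_ziggu_strings])
  then have "card {w. length w = n \<and> nurikabe_word w} = card (set (ziggu_strings n))"
    using card_nurikabe_words[of n] by simp
  then obtain \<psi> where "bij_betw \<psi> {w. length w = n \<and> nurikabe_word w} (set (ziggu_strings n))"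
    using finite_same_card_bij[OF finite_words finite_set] by blast
  with bij_betw_columns show ?thesis
    by (blast intro: bij_betw_trans)
qed

end
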